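(* Let $n$ be the number of columns of $\mathbf{A}$, let $g>0$ be the expected cost of evaluating a stochastic gradient $\nabla f_{\mathbf{S}}(x)$, and let $C_{\mathrm{mSGD}}(\beta)$ and $C_{\mathrm{smSGD}}(\beta n)$ be the total complexities (defined in the context) of mSGD with momentum parameter $\beta$ and of smSGD with momentum parameter $\beta n$, respectively. For small $\beta$, the total complexity of smSGD is approximately $1+n/g$ times smaller than the total complexity of mSGD, in the sense that $$\lim_{\beta\to0^+}\frac{C_{\mathrm{mSGD}}(\beta)}{C_{\mathrm{smSGD}}(\beta n)}=1+\frac ng .$$
   Context: Let $\mathbf{A}\in\mathbb{R}^{m\times n}$ and $b\in\mathbb{R}^m$ with $\mathbf{A}x=b$ consistent, and let $\mathcal{D}$ be a probability distribution over real matrices $\mathbf{S}$ with $m$ rows. Take $\mathbf{B}=\mathbf{I}$ and put $\mathbf{H}:=\mathbf{S}(\mathbf{S}^\top\mathbf{A}\mathbf{A}^\top\mathbf{S})^\dagger\mathbf{S}^\top$ ($\dagger$ = Moore–Penrose pseudoinverse), $f_{\mathbf{S}}(x):=\frac12(\mathbf{A}x-b)^\top\mathbf{H}(\mathbf{A}x-b)$, $\mathbf{W}:=\mathbb{E}_{\mathbf{S}\sim\mathcal{D}}[\mathbf{A}^\top\mathbf{H}\mathbf{A}]$. Let $\lambda_{\max}$ be the largest and $\lambda_{\min}^+$ the smallest nonzero eigenvalue of $\mathbf{W}$ (it is presupposed that $\mathbf{W}\ne0$); all eigenvalues of $\mathbf{W}$ lie in $[0,1]$. Methods compared, both with stepsize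 $\omega=1$: mSGD iterates $x_{k+1}=x_k-\nabla f_{\mathbf{S}_k}(x_k)+\beta(x_k-x_{k-1})$; smSGD with momentum parameter $\beta'$ iterates $x_{k+1}=x_k-\nabla f_{\mathbf{S}_k}(x_k)+\beta'e_{i_k}^\top(x_k-x_{k-1})e_{i_k}$ with $i_k$ uniform on $\{1,\dots,n\}$. With $\beta'=\beta n$ the stochastic momentum term is an unbiased estimator of the momentum term of mSGD. Convergence constants for $\omega=1$: for mSGD, $a_1(\beta)=1+3\beta+2\beta^2-(1+\beta)\lambda_{\min}^+$, $a_2(\beta)=\beta+2\beta^2+\beta\lambda_{\max}$, $q(\beta)=\frac{a_1(\beta)+\sqrt{a_1(\beta)^2+4a_2(\beta)}}{2}$; for smSGD, $\bar a_1(\beta')=1+3\frac{\beta'}{n}+2\frac{\beta'^2}{n}-\left(1+\frac{\beta'}{n}\right)\lambda_{\min}^+$, $\bar a_2(\beta')=\frac1n(\beta'+2\beta'^2+\beta'\lambda_{\max})$, $\bar q(\beta')=\frac{\bar a_1(\beta')+\sqrt{\bar a_1(\beta')^2+4\bar a_2(\beta')}}{2}$. One iteration of mSGD costs $g+n$ and one iteration of smSGD costs $g$ (ignoring constants). The total complexities (cost per iteration times number of iterations, ignoring constants) are defined by $$C_{\mathrm{mSGD}}(\beta):=\frac{g+n}{1-q(\beta)},\qquad C_{\mathrm{smSGD}}(\beta n):=\frac{g}{1-\bar q(\beta n)}.$$ *)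

theory Defs
  imports "HOL-Probability.Probability" "Jordan_Normal_Form.Spectral_Radius"
begin

text \<open>The four Penrose equations; they have exactly one solution for every real matrix.\<close>

definition is_pinv :: "real mat \<Rightarrow> real mat \<Rightarrow> bool" where
  "is_pinv M X \<longleftrightarrow>
     X \<in> carrier_mat (dim_col M) (dim_row M) \<and>
     M * X * M = M \<and>
     X * M * X = X \<and>
     transpose_mat (M * X) = M * X \<and>
     transpose_mat (X * M) = X * M"

definition pinv :: "real mat \<Rightarrow> real mat" where
  "pinv M = (THE X. is_pinv M X)"

text \<open>The Borel \<open>\<sigma>\<close>-algebra on the set of all real matrices with \<open>m\<close> rows, seen as the
  disjoint union over \<open>q\<close> of the Euclidean spaces of \<open>m \<times> q\<close> matrices.  The number of columns of
  a random matrix is thus not fixed.  Entries outside the dimensions are unspecified, hence the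
  restriction to \<open>i < m\<close> and \<open>j < q\<close>.\<close>

definition mat_borel :: "nat \<Rightarrow> real mat measure" where
  "mat_borel m = sigma {S. dim_row S = m}
     (range (carrier_mat m) \<union>
      {{S \<in> carrier_mat m q. S $$ (i, j) \<in> U} | q i j U.
         i < m \<and> j < q \<and> U \<in> sets borel})"

definition H_mat :: "real mat \<Rightarrow> real mat \<Rightarrow> real mat" where
  "H_mat A S = S * pinv (transpose_mat S * A * transpose_mat A * S) * transpose_mat S"

text \<open>The integrand is a Borel measurable orthogonal projection, so its entries are bounded and
  integrable for every probability distribution \<open>D\<close> on \<open>mat_borel (dim_row A)\<close>.\<close>

definition W_mat :: "real mat \<Rightarrow> real mat measure \<Rightarrow> real mat" where
  "W_mat A D = Matrix.mat (dim_col A) (dim_col A)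
     (\<lambda>(i, j). \<integral>S. (transpose_mat A * H_mat A S * A) $$ (i, j) \<partial>D)"

definition lambda_max :: "real mat \<Rightarrow> real" where
  "lambda_max W = Max (spectrum W)"

definition lambda_min_pos :: "real mat \<Rightarrow> real" where
  "lambda_min_pos W = Min (spectrum W - {0})"

definition a1_mSGD :: "real mat \<Rightarrow> real \<Rightarrow> real" where
  "a1_mSGD W \<beta> = 1 + 3 * \<beta> + 2 * \<beta>\<^sup>2 - (1 + \<beta>) * lambda_min_pos W"

definition a2_mSGD :: "real mat \<Rightarrow> real \<Rightarrow> real" where
  "a2_mSGD W \<beta> = \<beta> + 2 * \<beta>\<^sup>2 + \<beta> * lambda_max W"

definition q_mSGD :: "real mat \<Rightarrow> real \<Rightarrow> real" where
  "q_mSGD W \<beta> = (a1_mSGD W \<beta> + sqrt ((a1_mSGD W \<beta>)\<^sup>2 + 4 * a2_mSGD W \<beta>)) / 2"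

definition a1_smSGD :: "nat \<Rightarrow> real mat \<Rightarrow> real \<Rightarrow> real" where
  "a1_smSGD n W \<beta>' =
     1 + 3 * (\<beta>' / real n) + 2 * (\<beta>'\<^sup>2 / real n) - (1 + \<beta>' / real n) * lambda_min_pos W"

definition a2_smSGD :: "nat \<Rightarrow> real mat \<Rightarrow> real \<Rightarrow> real" where
  "a2_smSGD n W \<beta>' = 1 / real n * (\<beta>' + 2 * \<beta>'\<^sup>2 + \<beta>' * lambda_max W)"

definition q_smSGD :: "nat \<Rightarrow> real mat \<Rightarrow> real \<Rightarrow> real" where
  "q_smSGD n W \<beta>' = (a1_smSGD n W \<beta>' + sqrt ((a1_smSGD n W \<beta>')\<^sup>2 + 4 * a2_smSGD n W \<beta>')) / 2"

text \<open>Cost per iteration (\<open>g + n\<close>, respectively \<open>g\<close>) times the iteration count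
  \<open>1 / (1 - q)\<close>, for stepsize \<open>1\<close>.\<close>

definition C_mSGD :: "real \<Rightarrow> nat \<Rightarrow> real mat \<Rightarrow> real \<Rightarrow> real" where
  "C_mSGD g n W \<beta> = (g + real n) / (1 - q_mSGD W \<beta>)"

definition C_smSGD :: "real \<Rightarrow> nat \<Rightarrow> real mat \<Rightarrow> real \<Rightarrow> real" where
  "C_smSGD g n W \<beta>' = g / (1 - q_smSGD n W \<beta>')"

end

theory Submission
  imports Defs
begin

text \<open>Write \<open>l\<close> for the smallest nonzero eigenvalue of \<open>W\<close>.  At \<open>\<beta> = 0\<close> both momentum terms
  vanish, and both rates \<open>q(\<beta>)\<close> and \<open>q(\<beta>n)\<close> tend to the same number
  \<open>q\<^sub>0 = (1 - l + \<bar>1 - l\<bar>) / 2\<close>.  So the iteration counts cancel in the limit and only the quotient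
  \<open>(g + n) / g\<close> of the iteration costs remains, provided that \<open>1 - q\<^sub>0 \<noteq> 0\<close>.  Since \<open>q\<^sub>0\<close> is
  \<open>1 - l\<close> or \<open>0\<close>, this holds as soon as \<open>l \<noteq> 0\<close>.

  The work therefore lies in showing that \<open>W\<close> has a nonzero real eigenvalue at all, so that the
  minimum defining \<open>l\<close> is over a nonempty set.  This is a fact about nonzero symmetric matrices
  (\<open>symmetric_mat_nonzero_eigenvalue\<close>): otherwise all complex eigenvalues, being real, would be
  \<open>0\<close>, the Jordan normal form would be nilpotent, and a nilpotent symmetric matrix is zero.

  That \<open>W\<close> is symmetric (\<open>W_mat_symmetric\<close>) holds integrand by integrand and comes down to the
  symmetry of the pseudoinverse of a symmetric matrix.  As the pseudoinverse is a definite
  description, this includes its existence (\<open>pinv_symmetric\<close>).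

  Both facts rest on \<open>symmetric_mat_square_divides\<close>: a symmetric real \<open>M\<close> satisfies
  \<open>M = M\<^sup>2 Y\<close> for some symmetric \<open>Y\<close> commuting with \<open>M\<close>.  Then \<open>Y M Y\<close> is the
  pseudoinverse of \<open>M\<close>, and no positive power of \<open>M\<close> vanishes unless \<open>M\<close> does.\<close>

section \<open>Symmetric real matrices\<close>

text \<open>The diagonal entries of a Gram matrix are the squared norms of the columns.\<close>

lemma gram_mat_eq_0:
  fixes N :: "real mat"
  assumes N: "N \<in> carrier_mat n p" and gram: "transpose_mat N * N = 0\<^sub>m p p"
  shows "N = 0\<^sub>m n p"
proof (rule eq_matI)
  fix i j assume "i < dim_row (0\<^sub>m n p :: real mat)" "j < dim_col (0\<^sub>m n p :: real mat)"
  then have i: "i < n" and j: "j < p" by auto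
  have "(transpose_mat N * N) $$ (j, j) = (\<Sum>k = 0..<n. (N $$ (k, j))\<^sup>2)"
    using N j by (simp add: scalar_prod_def power2_eq_square)
  then have "(\<Sum>k = 0..<n. (N $$ (k, j))\<^sup>2) = 0"
    using gram j by simp
  then have "(N $$ (i, j))\<^sup>2 = 0"
    using i by (subst (asm) sum_nonneg_eq_0_iff) auto
  then show "N $$ (i, j) = 0\<^sub>m n p $$ (i, j)" using i j by simp
qed (use N in auto)

text \<open>The kernels of \<open>M\<^sup>2\<close> and \<open>M\<close> agree, because \<open>Z\<^sup>T (M\<^sup>2 Z)\<close> is the Gram matrix of
  \<open>M Z\<close>.\<close>

lemma symmetric_mat_cancel:
  fixes M :: "real mat"
  assumes M: "M \<in> carrier_mat n n" and sym: "transpose_mat M = M"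
    and Z: "Z \<in> carrier_mat n p" and zero: "M * (M * Z) = 0\<^sub>m n p"
  shows "M * Z = 0\<^sub>m n p"
proof (rule gram_mat_eq_0)
  show MZ: "M * Z \<in> carrier_mat n p" using M Z by simp
  have "transpose_mat (M * Z) * (M * Z) = transpose_mat Z * (M * (M * Z))"
    using M Z sym by (simp add: transpose_mult[OF M Z] assoc_mult_mat[of _ p n _ n _ p])
  also have "\<dots> = 0\<^sub>m p p" using Z zero by simp
  finally show "transpose_mat (M * Z) * (M * Z) = 0\<^sub>m p p" .
qed

text \<open>Evaluation of the polynomial with coefficient list \<open>cs\<close> at a matrix, in Horner form so
  that splitting off the factor \<open>x\<close> is structural recursion on the list.\<close>

fun horner_mat :: "'a :: comm_ring_1 mat \<Rightarrow> 'a list \<Rightarrow> 'a mat" where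
  "horner_mat M [] = 0\<^sub>m (dim_row M) (dim_row M)"
| "horner_mat M (c # cs) = c \<cdot>\<^sub>m 1\<^sub>m (dim_row M) + M * horner_mat M cs"

lemma horner_mat_carrier:
  "M \<in> carrier_mat n n \<Longrightarrow> horner_mat M cs \<in> carrier_mat n n"
  by (induction cs) auto

lemma horner_mat_commute:
  assumes M: "M \<in> carrier_mat n n"
  shows "M * horner_mat M cs = horner_mat M cs * M"
proof (induction cs)
  case (Cons c cs)
  have H: "horner_mat M cs \<in> carrier_mat n n" by (rule horner_mat_carrier[OF M])
  have MH: "M * horner_mat M cs \<in> carrier_mat n n" using M H by simp
  have "M * (c \<cdot>\<^sub>m 1\<^sub>m n + M * horner_mat M cs) = c \<cdot>\<^sub>m M + M * (M * horner_mat M cs)"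
    using mult_add_distrib_mat[OF M _ MH, of "c \<cdot>\<^sub>m 1\<^sub>m n"] mult_smult_distrib[OF M, of "1\<^sub>m n" n c] M
    by simp
  moreover have "(c \<cdot>\<^sub>m 1\<^sub>m n + M * horner_mat M cs) * M = c \<cdot>\<^sub>m M + M * (horner_mat M cs * M)"
    using add_mult_distrib_mat[OF _ MH M, of "c \<cdot>\<^sub>m 1\<^sub>m n"] mult_smult_assoc_mat[of "1\<^sub>m n" n n M n c]
      assoc_mult_mat[OF M H M] M by simp
  ultimately show ?case using M Cons by simp
qed (use M in auto)

lemma transpose_horner_mat:
  assumes M: "M \<in> carrier_mat n n" and sym: "transpose_mat M = M"
  shows "transpose_mat (horner_mat M cs) = horner_mat M cs"
proof (induction cs)
  case (Cons c cs)
  have H: "horner_mat M cs \<in> carrier_mat n n" by (rule horner_mat_carrier[OF M])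
  have one: "transpose_mat (c \<cdot>\<^sub>m 1\<^sub>m n) = (c \<cdot>\<^sub>m 1\<^sub>m n :: 'a mat)"
    by (intro eq_matI) auto
  show ?case
    using M H Cons sym horner_mat_commute[OF M, of cs]
    by (simp add: transpose_add[of _ n n] transpose_mult[OF H M] one)
qed (use M in auto)

lemma horner_mat_index:
  assumes M: "M \<in> carrier_mat n n" and "i < n" "j < n"
  shows "horner_mat M cs $$ (i, j) = (\<Sum>k<length cs. cs ! k * (M ^\<^sub>m k) $$ (i, j))"
  using assms(2,3)
proof (induction cs arbitrary: i j)
  case (Cons c cs)
  have pow_Suc_left: "M * M ^\<^sub>m k = M ^\<^sub>m Suc k" for k
  proof (induction k)
    case (Suc k)
    have "M * M ^\<^sub>m Suc k = (M * M ^\<^sub>m k) * M"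
      using M by (simp add: assoc_mult_mat[of _ n n _ n _ n])
    with Suc show ?case by simp
  qed (use M in auto)
  have H: "horner_mat M cs \<in> carrier_mat n n" by (rule horner_mat_carrier[OF M])
  have "(M * horner_mat M cs) $$ (i, j) = (\<Sum>l = 0..<n. M $$ (i, l) * horner_mat M cs $$ (l, j))"
    using M H Cons.prems by (auto simp: scalar_prod_def)
  also have "\<dots> = (\<Sum>l = 0..<n. \<Sum>k<length cs. cs ! k * (M $$ (i, l) * (M ^\<^sub>m k) $$ (l, j)))"
    using Cons.IH Cons.prems by (auto simp: sum_distrib_left algebra_simps intro!: sum.cong)
  also have "\<dots> = (\<Sum>k<length cs. cs ! k * (M * M ^\<^sub>m k) $$ (i, j))"
    using M Cons.prems by (subst sum.swap) (auto simp: scalar_prod_def sum_distrib_left)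
  finally have "(M * horner_mat M cs) $$ (i, j) = (\<Sum>k<length cs. cs ! k * (M ^\<^sub>m Suc k) $$ (i, j))"
    by (simp only: pow_Suc_left)
  then show ?case
    using M H Cons.prems by (simp add: sum.lessThan_Suc_shift del: sum.lessThan_Suc pow_mat.simps(2))
qed (use M in auto)

text \<open>The space of \<open>n \<times> n\<close> matrices has dimension \<open>n\<^sup>2\<close>, so the first \<open>n\<^sup>2 + 1\<close> powers of a
  matrix are linearly dependent.\<close>

lemma annihilating_polynomial:
  fixes M :: "'a :: field mat"
  assumes M: "M \<in> carrier_mat n n"
  shows "\<exists>cs. (\<exists>c\<in>set cs. c \<noteq> 0) \<and> horner_mat M cs = 0\<^sub>m n n"
proof -
  define N where "N = Suc (n * n)"
  \<comment> \<open>Column \<open>k\<close> of this square matrix lists the entries of the \<open>k\<close>-th power of \<open>M\<close>; the extra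
    row of zeros makes it singular.\<close>
  define c where "c r = Matrix.vec N (\<lambda>k. (M ^\<^sub>m k) $$ (r div n, r mod n))" for r
  define P where "P = mat\<^sub>r N N (\<lambda>r. if r = n * n then 0\<^sub>v N else c r)"
  have P: "P \<in> carrier_mat N N" by (simp add: P_def)
  have "det P = 0" unfolding P_def by (rule det_row_0) (auto simp: N_def c_def)
  then obtain v where v: "v \<in> carrier_vec N" "v \<noteq> 0\<^sub>v N" and Pv: "P *\<^sub>v v = 0\<^sub>v N"
    using det_0_iff_vec_prod_zero_field[OF P] by auto
  let ?cs = "list_of_vec v"
  have len: "length ?cs = N" using v by simp
  have nth: "?cs ! k = v $ k" if "k < N" for k
    using that v by (simp add: list_of_vec_index)
  obtain k where "k < N" "v $ k \<noteq> 0"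
    using v by (metis carrier_vecD eq_vecI index_zero_vec)
  then have "\<exists>c\<in>set ?cs. c \<noteq> 0" using len nth by (metis nth_mem)
  moreover have "horner_mat M ?cs = 0\<^sub>m n n"
  proof (rule eq_matI)
    fix i j assume "i < dim_row (0\<^sub>m n n :: 'a mat)" "j < dim_col (0\<^sub>m n n :: 'a mat)"
    then have i: "i < n" and j: "j < n" by auto
    define r where "r = i * n + j"
    have "r < Suc i * n" using j by (simp add: r_def)
    also have "\<dots> \<le> n * n" using i by (intro mult_right_mono) auto
    finally have r: "r < n * n" .
    have rdiv: "r div n = i" "r mod n = j" using j by (auto simp: r_def)
    have "(P *\<^sub>v v) $ r = (\<Sum>k<N. (M ^\<^sub>m k) $$ (i, j) * v $ k)"
      using r v by (simp add: P_def N_def c_def scalar_prod_def rdiv lessThan_atLeast0)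
    then have "(\<Sum>k<N. (M ^\<^sub>m k) $$ (i, j) * v $ k) = 0"
      using Pv r by (simp add: N_def)
    then show "horner_mat M ?cs $$ (i, j) = 0\<^sub>m n n $$ (i, j)"
      using horner_mat_index[OF M i j, of ?cs] i j len nth by (simp add: mult.commute)
  qed (use M horner_mat_carrier[OF M, of ?cs] in auto)
  ultimately show ?thesis by blast
qed

text \<open>Divide an annihilating polynomial by its largest power of \<open>x\<close>.  By symmetry a single factor
  \<open>M\<close> may be cancelled repeatedly until \<open>M (c + M h(M)) = 0\<close> with \<open>c \<noteq> 0\<close>; then
  \<open>Y = - h(M) / c\<close>, which is symmetric and commutes with \<open>M\<close> as a polynomial in \<open>M\<close>.\<close>

lemma symmetric_mat_square_divides:
  fixes M :: "real mat"
  assumes M: "M \<in> carrier_mat n n" and sym: "transpose_mat M = M"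
  obtains Y where "Y \<in> carrier_mat n n" "transpose_mat Y = Y" "M * Y = Y * M" "M = M * (M * Y)"
proof -
  \<comment> \<open>The extra factor \<open>M\<close> in the hypothesis lets the induction remove vanishing low-order
    coefficients while always leaving one \<open>M\<close> in front.\<close>
  have *: "\<exists>Y. Y \<in> carrier_mat n n \<and> transpose_mat Y = Y \<and> M * Y = Y * M \<and> M = M * (M * Y)"
    if "\<exists>c\<in>set cs. c \<noteq> 0" "M * horner_mat M cs = 0\<^sub>m n n" for cs
    using that
  proof (induction cs)
    case (Cons c cs)
    let ?H = "horner_mat M cs"
    have H: "?H \<in> carrier_mat n n" by (rule horner_mat_carrier[OF M])
    have eq: "c \<cdot>\<^sub>m M + M * (M * ?H) = 0\<^sub>m n n"
      using mult_add_distrib_mat[OF M, of "c \<cdot>\<^sub>m 1\<^sub>m n" n "M * ?H"]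
        mult_smult_distrib[OF M, of "1\<^sub>m n" n c] M H Cons.prems(2) by simp
    show ?case
    proof (cases "c = 0")
      case True
      have "0 \<cdot>\<^sub>m M = 0\<^sub>m n n" using M by (intro eq_matI) auto
      then have "M * (M * ?H) = 0\<^sub>m n n" using eq M H True by simp
      then have "M * ?H = 0\<^sub>m n n" by (rule symmetric_mat_cancel[OF M sym H])
      with Cons True show ?thesis by auto
    next
      case False
      define Y where "Y = (- 1 / c) \<cdot>\<^sub>m ?H"
      have "M = M * (M * Y)"
      proof (rule eq_matI)
        fix i j assume "i < dim_row (M * (M * Y))" "j < dim_col (M * (M * Y))"
        then have ij: "i < n" "j < n" using M H by (auto simp: Y_def)
        have MMY: "M * (M * Y) = (- 1 / c) \<cdot>\<^sub>m (M * (M * ?H))"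
          using mult_smult_distrib[OF M H, of "- 1 / c"] mult_smult_distrib[OF M, of "M * ?H" n "- 1 / c"] M H
          by (simp add: Y_def)
        have "c * M $$ (i, j) + (M * (M * ?H)) $$ (i, j) = 0"
          using arg_cong[OF eq, of "\<lambda>X. X $$ (i, j)"] ij M H by auto
        moreover have "(M * (M * Y)) $$ (i, j) = (- 1 / c) * (M * (M * ?H)) $$ (i, j)"
          unfolding MMY using ij M H by (intro index_smult_mat) auto
        ultimately have "c * M $$ (i, j) = c * (M * (M * Y)) $$ (i, j)"
          using False by simp
        then show "M $$ (i, j) = (M * (M * Y)) $$ (i, j)" using False by simp
      qed (use M H in \<open>auto simp: Y_def\<close>)
      moreover have "M * Y = Y * M"
        using M H horner_mat_commute[OF M, of cs]
        by (simp add: Y_def mult_smult_distrib[of _ n n] mult_smult_assoc_mat[of _ n n])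
      moreover have "transpose_mat Y = Y"
      proof -
        have "transpose_mat Y = (- 1 / c) \<cdot>\<^sub>m transpose_mat ?H"
          unfolding Y_def by (intro eq_matI) auto
        then show ?thesis using transpose_horner_mat[OF M sym] by (simp add: Y_def)
      qed
      moreover have "Y \<in> carrier_mat n n" using H by (simp add: Y_def)
      ultimately show ?thesis by blast
    qed
  qed auto
  obtain cs where "\<exists>c\<in>set cs. c \<noteq> 0" "horner_mat M cs = 0\<^sub>m n n"
    using annihilating_polynomial[OF M] by auto
  with *[of cs] M that show ?thesis by auto
qed

section \<open>The pseudoinverse\<close>

text \<open>Both \<open>M X\<close> and \<open>M Y\<close> are the orthogonal projection onto the range of \<open>M\<close>, and both
  \<open>X M\<close> and \<open>Y M\<close> the one onto the range of the transpose, so they coincide in pairs.\<close>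

lemma is_pinv_unique:
  assumes X: "is_pinv M X" and Y: "is_pinv M Y"
  shows "X = Y"
proof -
  define a b where "a = dim_row M" and "b = dim_col M"
  have M: "M \<in> carrier_mat a b" by (auto simp: a_def b_def)
  have Xc: "X \<in> carrier_mat b a" and Yc: "Y \<in> carrier_mat b a"
    using X Y by (auto simp: is_pinv_def a_def b_def)
  have left: "M * X = M * Y"
  proof -
    have "M * X = transpose_mat (M * Y * (M * X))"
    proof -
      have "M * Y * (M * X) = M * Y * M * X"
        using M Xc Yc by (intro assoc_mult_mat[symmetric, of _ a a _ b _ a]) auto
      then show ?thesis using X Y by (simp add: is_pinv_def)
    qed
    also have "\<dots> = M * X * (M * Y)"
      using transpose_mult[of "M * Y" a a "M * X" a] M Xc Yc X Y by (simp add: is_pinv_def)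
    also have "\<dots> = M * X * M * Y"
      using M Xc Yc by (intro assoc_mult_mat[symmetric, of _ a a _ b _ a]) auto
    finally show ?thesis using X by (simp add: is_pinv_def)
  qed
  have right: "X * M = Y * M"
  proof -
    have "X * M = transpose_mat (X * M * (Y * M))"
    proof -
      have "X * M * (Y * M) = X * (M * Y * M)"
        using M Xc Yc by (simp add: assoc_mult_mat[of X b a M b "Y * M" b] assoc_mult_mat[of M a b Y a M b])
      then show ?thesis using X Y by (simp add: is_pinv_def)
    qed
    also have "\<dots> = Y * M * (X * M)"
      using transpose_mult[of "X * M" b b "Y * M" b] M Xc Yc X Y by (simp add: is_pinv_def)
    also have "\<dots> = Y * (M * X * M)"
      using M Xc Yc by (simp add: assoc_mult_mat[of Y b a M b "X * M" b] assoc_mult_mat[of M a b X a M b])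
    finally show ?thesis using X by (simp add: is_pinv_def)
  qed
  have "X = X * M * X" using X by (simp add: is_pinv_def)
  also have "\<dots> = Y * (M * X)"
    unfolding right using M Xc Yc by (simp add: assoc_mult_mat[of Y b a M b X a])
  also have "\<dots> = Y * M * Y"
    unfolding left using M Xc Yc by (simp add: assoc_mult_mat[of Y b a M b Y a])
  also have "\<dots> = Y" using Y by (simp add: is_pinv_def)
  finally show ?thesis .
qed

text \<open>With \<open>M = M\<^sup>2 Y\<close> as above, \<open>X = Y M Y\<close> solves the Penrose equations, and
  \<open>M X = M Y = X M\<close> is the projection onto the range of \<open>M\<close>.\<close>

lemma pinv_symmetric:
  fixes M :: "real mat"
  assumes M: "M \<in> carrier_mat n n" and sym: "transpose_mat M = M"
  shows "pinv M \<in> carrier_mat n n" "transpose_mat (pinv M) = pinv M"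
proof -
  obtain Y where Y: "Y \<in> carrier_mat n n" and symY: "transpose_mat Y = Y"
    and comm: "M * Y = Y * M" and sq: "M = M * (M * Y)"
    using symmetric_mat_square_divides[OF M sym] .
  note assoc = assoc_mult_mat[of _ n n _ n _ n]
  define X where "X = Y * (M * Y)"
  have Xc: "X \<in> carrier_mat n n" using M Y by (simp add: X_def)
  have MX: "M * X = M * Y"
  proof -
    have "M * X = (M * Y) * (M * Y)" using M Y by (simp add: X_def assoc)
    also have "\<dots> = (Y * M) * (M * Y)" by (simp only: comm)
    also have "\<dots> = Y * (M * (M * Y))" using M Y by (intro assoc) auto
    finally show ?thesis using sq comm by simp
  qed
  have symX: "transpose_mat X = X"
  proof -
    have "transpose_mat X = transpose_mat (M * Y) * transpose_mat Y"
      unfolding X_def using M Y by (intro transpose_mult[of _ n n]) auto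
    also have "transpose_mat (M * Y) = Y * M"
      using transpose_mult[OF M Y] sym symY by simp
    finally show ?thesis using M Y symY by (simp add: X_def assoc)
  qed
  have symMX: "transpose_mat (M * X) = M * X"
    using transpose_mult[OF M Y] sym symY comm MX by simp
  have XM: "X * M = M * X"
    using transpose_mult[OF M Xc] symMX sym symX by simp
  have "is_pinv M X"
  proof -
    have "M * X * M = M"
    proof -
      have "M * X * M = M * (Y * M)" using M Y by (simp add: MX assoc)
      then show ?thesis using sq comm by simp
    qed
    moreover have "X * M * X = X"
    proof -
      have "X * M * X = Y * M * X" by (simp add: XM MX comm)
      also have "\<dots> = Y * (M * X)" using M Y Xc by (simp add: assoc)
      also have "\<dots> = Y * (M * Y)" by (simp only: MX)
      finally show ?thesis by (simp only: X_def[symmetric])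
    qed
    ultimately show ?thesis using M Xc symMX XM by (simp add: is_pinv_def)
  qed
  then have "pinv M = X"
    unfolding pinv_def by (intro the_equality) (auto intro: is_pinv_unique)
  with Xc symX show "pinv M \<in> carrier_mat n n" "transpose_mat (pinv M) = pinv M" by auto
qed

section \<open>The expected projection\<close>

lemma transpose_congruence:
  fixes P :: "'a :: comm_ring_1 mat"
  assumes C: "C \<in> carrier_mat m n" and P: "P \<in> carrier_mat m m" and sym: "transpose_mat P = P"
  shows "transpose_mat (transpose_mat C * P * C) = transpose_mat C * P * C"
proof -
  have CP: "transpose_mat C * P \<in> carrier_mat n m" using C P by simp
  have "transpose_mat (transpose_mat C * P * C) = transpose_mat C * (P * C)"
    using transpose_mult[OF CP C] transpose_mult[of "transpose_mat C" n m P m] C P sym by simp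
  then show ?thesis using C P by (simp add: assoc_mult_mat[of _ n m _ m _ n])
qed

lemma H_mat_symmetric:
  assumes A: "A \<in> carrier_mat m n" and S: "dim_row S = m"
  shows "H_mat A S \<in> carrier_mat m m" "transpose_mat (H_mat A S) = H_mat A S"
proof -
  define q where "q = dim_col S"
  have Sc: "S \<in> carrier_mat m q" using S by (auto simp: q_def)
  define M where "M = transpose_mat S * A * transpose_mat A * S"
  have M: "M \<in> carrier_mat q q" 
    using A Sc by (intro carrier_matI) (simp_all add: M_def)
  have "M = transpose_mat S * (A * transpose_mat A) * S"
    using A Sc by (simp add: M_def assoc_mult_mat[of _ q m _ n _ m])
  moreover have "transpose_mat (A * transpose_mat A) = A * transpose_mat A"
    using transpose_mult[of A m n "transpose_mat A" m] A by simp
  ultimately have sym: "transpose_mat M = M"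
    using transpose_congruence[OF Sc, of "A * transpose_mat A"] A by simp
  note P = pinv_symmetric[OF M sym]
  have H: "H_mat A S = S * pinv M * transpose_mat S" by (simp add: H_mat_def M_def)
  show "H_mat A S \<in> carrier_mat m m" unfolding H using Sc P by simp
  show "transpose_mat (H_mat A S) = H_mat A S"
    unfolding H using transpose_congruence[of "transpose_mat S" q m "pinv M"] Sc P by simp
qed

text \<open>The two integrals at mirrored positions have equal integrands on the whole space, hence are
  equal by congruence alone.\<close>

lemma W_mat_symmetric:
  assumes A: "A \<in> carrier_mat m n" and D: "sets D = sets (mat_borel m)"
  shows "W_mat A D \<in> carrier_mat n n" "transpose_mat (W_mat A D) = W_mat A D"
proof -
  show carrier: "W_mat A D \<in> carrier_mat n n" using A by (simp add: W_mat_def)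
  have "space D = space (mat_borel m)" by (rule sets_eq_imp_space_eq[OF D])
  also have "\<dots> = {S. dim_row S = m}"
    unfolding mat_borel_def by (rule space_measure_of) auto
  finally have space: "space D = {S. dim_row S = m}" .
  have sym: "(\<integral>S. (transpose_mat A * H_mat A S * A) $$ (i, j) \<partial>D) =
      (\<integral>S. (transpose_mat A * H_mat A S * A) $$ (j, i) \<partial>D)" if "i < n" "j < n" for i j
  proof (rule Bochner_Integration.integral_cong)
    fix S assume "S \<in> space D"
    then have S: "dim_row S = m" using space by simp
    let ?G = "transpose_mat A * H_mat A S * A"
    have "transpose_mat ?G = ?G"
      by (rule transpose_congruence[OF A H_mat_symmetric[OF A S]])
    moreover have "transpose_mat ?G $$ (j, i) = ?G $$ (i, j)"
      using A that by (intro index_transpose_mat) auto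
    ultimately show "?G $$ (i, j) = ?G $$ (j, i)" by simp
  qed simp
  show "transpose_mat (W_mat A D) = W_mat A D"
    by (rule eq_matI) (use A sym in \<open>auto simp: W_mat_def\<close>)
qed

section \<open>Nonzero eigenvalues of symmetric matrices\<close>

text \<open>For a complex eigenvector \<open>v\<close>, moving the real symmetric matrix across the Hermitian
  product of \<open>v\<close> with itself turns the eigenvalue into its conjugate.\<close>

lemma symmetric_mat_complex_eigenvalue_real:
  fixes M :: "real mat"
  assumes M: "M \<in> carrier_mat n n" and sym: "transpose_mat M = M"
    and ev: "eigenvalue (map_mat complex_of_real M) a"
  shows "a \<in> \<real>"
proof -
  let ?C = "map_mat complex_of_real M"
  have C: "?C \<in> carrier_mat n n" using M by simp
  have symC: "transpose_mat ?C = ?C"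
    using sym map_mat_transpose[of complex_of_real M] by simp
  obtain v where v: "v \<in> carrier_vec n" "v \<noteq> 0\<^sub>v n" and Cv: "?C *\<^sub>v v = a \<cdot>\<^sub>v v"
    using ev M by (auto simp: eigenvalue_def eigenvector_def)
  have Ccv: "?C *\<^sub>v conjugate v = cnj a \<cdot>\<^sub>v conjugate v"
  proof -
    have "?C *\<^sub>v conjugate v = conjugate (?C *\<^sub>v v)"
    proof (rule eq_vecI)
      fix i assume "i < dim_vec (conjugate (?C *\<^sub>v v))"
      then show "(?C *\<^sub>v conjugate v) $ i = conjugate (?C *\<^sub>v v) $ i"
        using M v by (auto simp: scalar_prod_def cnj_sum)
    qed (use M v in auto)
    then show ?thesis by (simp add: Cv conjugate_smult_vec)
  qed
  have "a * (v \<bullet>c v) = (?C *\<^sub>v v) \<bullet>c v" using v by (simp add: Cv)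
  also have "\<dots> = v \<bullet> (?C *\<^sub>v conjugate v)"
    using transpose_vec_mult_scalar[OF C, of "conjugate v" v] v symC by simp
  also have "\<dots> = cnj a * (v \<bullet>c v)" using v by (simp add: Ccv)
  finally have "a * (v \<bullet>c v) = cnj a * (v \<bullet>c v)" .
  moreover have "v \<bullet>c v \<noteq> 0" using v by simp
  ultimately show ?thesis by (simp add: Reals_cnj_iff)
qed

lemma symmetric_mat_char_poly_splits:
  fixes M :: "real mat"
  assumes M: "M \<in> carrier_mat n n" and sym: "transpose_mat M = M"
  shows "\<exists>as. char_poly M = (\<Prod>a\<leftarrow>as. [:- a, 1:])"
proof -
  let ?C = "map_mat complex_of_real M"
  have C: "?C \<in> carrier_mat n n" using M by simp
  obtain as where as: "char_poly ?C = (\<Prod>a\<leftarrow>as. [:- a, 1:])"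
    using char_poly_factorized[OF C] by auto
  have real: "a \<in> \<real>" if "a \<in> set as" for a
  proof (rule symmetric_mat_complex_eigenvalue_real[OF M sym])
    show "eigenvalue ?C a"
      unfolding eigenvalue_root_char_poly[OF C] as using that
      by (auto simp: poly_prod_list prod_list_zero_iff)
  qed
  have cp: "char_poly ?C = map_poly complex_of_real (char_poly M)"
    by (rule of_real_hom.char_poly_hom[OF M])
  interpret hom: map_poly_comm_ring_hom complex_of_real ..
  have "(\<Prod>a\<leftarrow>as. [:- a, 1:]) = map_poly complex_of_real (\<Prod>a\<leftarrow>map Re as. [:- a, 1:])"
    using real
  proof (induction as)
    case (Cons a as)
    have "[:- a, 1:] = map_poly complex_of_real [:- Re a, 1:]"
      using Cons.prems by (simp add: map_poly_pCons complex_is_Real_iff complex_eq_iff)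
    then show ?case using Cons by (simp add: hom.hom_mult del: map_poly_pCons mult_pCons_left)
  qed simp
  then have "map_poly complex_of_real (char_poly M) = map_poly complex_of_real (\<Prod>a\<leftarrow>map Re as. [:- a, 1:])"
    using as cp by simp
  then have "char_poly M = (\<Prod>a\<leftarrow>map Re as. [:- a, 1:])"
    by (simp add: poly_eq_iff coeff_map_poly)
  then show ?thesis by blast
qed

lemma jordan_matrix_nilpotent:
  assumes zero: "\<And>k a. (k, a) \<in> set n_as \<Longrightarrow> a = (0 :: 'a :: comm_ring_1)"
    and bound: "\<And>k a. (k, a) \<in> set n_as \<Longrightarrow> k \<le> r"
  shows "elements_mat (jordan_matrix n_as ^\<^sub>m r) \<subseteq> {0}"
proof -
  have "elements_mat (jordan_block k a ^\<^sub>m r) \<subseteq> {0}" if "(k, a) \<in> set n_as" for k a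
    using zero[OF that] bound[OF that] by (auto simp: jordan_block_pow elements_mat_def power_0_left)
  then show ?thesis
    unfolding jordan_matrix_pow
    by (intro order.trans[OF elements_diag_block_mat]) force
qed

text \<open>If \<open>0\<close> were the only real eigenvalue, all Jordan blocks would belong to \<open>0\<close> and some power of
  \<open>M\<close> would vanish; \<open>M = M\<^sup>2 Y\<close> then forces \<open>M = 0\<close>.\<close>

lemma symmetric_mat_nonzero_eigenvalue:
  fixes M :: "real mat"
  assumes M: "M \<in> carrier_mat n n" and sym: "transpose_mat M = M" and nonzero: "M \<noteq> 0\<^sub>m n n"
  shows "\<exists>a. eigenvalue M a \<and> a \<noteq> 0"
proof (rule ccontr)
  assume "\<not> ?thesis"
  then have zero: "a = 0" if "eigenvalue M a" for a using that by auto
  obtain n_as where jnf: "jordan_nf M n_as"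
    using symmetric_mat_char_poly_splits[OF M sym] jordan_nf_iff_linear_factorization[OF M] by auto
  obtain P Q where P: "P \<in> carrier_mat n n" and Q: "Q \<in> carrier_mat n n"
    and cp: "char_poly M = (\<Prod>(k, a)\<leftarrow>n_as. [:- a, 1:] ^ k)"
    and pow: "\<And>r. M ^\<^sub>m r = P * jordan_matrix n_as ^\<^sub>m r * Q"
    using jordan_nf_powE[OF M jnf] by metis
  \<comment> \<open>The dimension of the Jordan matrix, so an exponent that kills every nilpotent block.\<close>
  define r where "r = sum_list (map fst n_as)"
  have blocks_zero: "a = 0" if mem: "(k, a) \<in> set n_as" for k a
  proof (rule zero)
    have "k \<noteq> 0" using jnf mem by (force simp: jordan_nf_def)
    then show "eigenvalue M a"
      unfolding eigenvalue_root_char_poly[OF M] cp using mem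
      by (force simp: poly_prod_list prod_list_zero_iff)
  qed
  have "k \<le> r" if "(k, a) \<in> set n_as" for k a
    unfolding r_def using that by (intro member_le_sum_list) force+
  with blocks_zero have J0: "elements_mat (jordan_matrix n_as ^\<^sub>m r) \<subseteq> {0}"
    by (rule jordan_matrix_nilpotent)
  have rn: "r = n"
  proof -
    obtain l where "M \<in> carrier_mat l l" "jordan_matrix n_as \<in> carrier_mat l l"
      using jnf unfolding jordan_nf_def by (auto dest!: similar_matD)
    then show ?thesis
      using M jordan_matrix_carrier[of n_as] unfolding r_def by (metis carrier_matD(1))
  qed
  have J: "jordan_matrix n_as ^\<^sub>m r \<in> carrier_mat n n"
    using rn by (intro pow_carrier_mat) (metis jordan_matrix_carrier r_def)
  have "jordan_matrix n_as ^\<^sub>m r = 0\<^sub>m n n"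
  proof (rule eq_matI)
    fix i j assume "i < dim_row (0\<^sub>m n n :: real mat)" "j < dim_col (0\<^sub>m n n :: real mat)"
    then show "(jordan_matrix n_as ^\<^sub>m r) $$ (i, j) = 0\<^sub>m n n $$ (i, j)"
      using elements_matI[OF J, of i j] J0 by auto
  qed (use carrier_matD[OF J] in \<open>simp_all only: index_zero_mat\<close>)
  then have nil: "M ^\<^sub>m r = 0\<^sub>m n n" using pow[of r] P Q by simp
  obtain Y where Y: "Y \<in> carrier_mat n n" and sq: "M = M * (M * Y)"
    using symmetric_mat_square_divides[OF M sym] by metis
  \<comment> \<open>Replacing one factor \<open>M\<close> by \<open>M\<^sup>2 Y\<close> shows that the vanishing of a power passes to the
    previous one, down to \<open>M\<close> itself.\<close>
  have "M ^\<^sub>m Suc k = 0\<^sub>m n n \<Longrightarrow> M = 0\<^sub>m n n" for k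
  proof (induction k)
    case (Suc k)
    have "M ^\<^sub>m Suc k = M ^\<^sub>m k * (M * (M * Y))" using sq by simp
    also have "\<dots> = M ^\<^sub>m Suc (Suc k) * Y"
      using M Y by (simp add: assoc_mult_mat[of _ n n _ n _ n])
    also have "\<dots> = 0\<^sub>m n n" using Suc.prems Y by simp
    finally show ?case by (rule Suc.IH)
  qed (use M in simp)
  from this[of r] have "M = 0\<^sub>m n n" using nil M by simp
  with nonzero show False by simp
qed

lemma lambda_min_pos_nonzero:
  assumes "W \<in> carrier_mat n n" "transpose_mat W = W" "W \<noteq> 0\<^sub>m n n"
  shows "lambda_min_pos W \<noteq> 0"
proof -
  have "finite (spectrum W - {0})" using card_finite_spectrum[OF assms(1)] by simp
  moreover have "spectrum W - {0} \<noteq> {}"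
    using symmetric_mat_nonzero_eigenvalue[OF assms] by (auto simp: spectrum_def)
  ultimately have "lambda_min_pos W \<in> spectrum W - {0}"
    unfolding lambda_min_pos_def by (rule Min_in)
  then show ?thesis by simp
qed

section \<open>The complexity ratio\<close>

lemma q_mSGD_tendsto:
  "(q_mSGD W \<longlongrightarrow> (1 - lambda_min_pos W + \<bar>1 - lambda_min_pos W\<bar>) / 2) (at_right 0)"
  unfolding q_mSGD_def a1_mSGD_def a2_mSGD_def
  by (auto intro!: tendsto_eq_intros)

lemma q_smSGD_tendsto:
  assumes "n > 0"
  shows "((\<lambda>\<beta>. q_smSGD n W (\<beta> * real n)) \<longlongrightarrow>
    (1 - lambda_min_pos W + \<bar>1 - lambda_min_pos W\<bar>) / 2) (at_right 0)"
  unfolding q_smSGD_def a1_smSGD_def a2_smSGD_def using assms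
  by (auto intro!: tendsto_eq_intros)

theorem theorem8:
  fixes A :: "real mat" and b :: "real Matrix.vec" and m n :: nat
    and D :: "real mat measure" and g :: real
  assumes "A \<in> carrier_mat m n"
    and "b \<in> carrier_vec m"
    and "\<exists>x \<in> carrier_vec n. A *\<^sub>v x = b"
    and "prob_space D"
    and "sets D = sets (mat_borel m)"
    and "W_mat A D \<noteq> 0\<^sub>m n n"
    and "g > 0"
  shows "((\<lambda>\<beta>. C_mSGD g n (W_mat A D) \<beta> / C_smSGD g n (W_mat A D) (\<beta> * real n))
           \<longlongrightarrow> 1 + real n / g) (at_right 0)"
proof -
  define W where "W = W_mat A D"
  note W = W_mat_symmetric[OF assms(1,5), folded W_def]
  \<comment> \<open>Needed because the constants of the stochastic method divide by \<open>n\<close>.\<close>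
  have "n > 0"
  proof (rule ccontr)
    assume "\<not> n > 0"
    then have "W = 0\<^sub>m n n" using W(1) by (intro eq_matI) auto
    with assms(6) show False by (simp add: W_def)
  qed
  define q0 where "q0 = (1 - lambda_min_pos W + \<bar>1 - lambda_min_pos W\<bar>) / 2"
  \<comment> \<open>\<open>1 - q0\<close> is \<open>l\<close> if \<open>l \<le> 1\<close> and \<open>1\<close> otherwise.\<close>
  have q0: "1 - q0 \<noteq> 0"
    using lambda_min_pos_nonzero[OF W] assms(6) by (auto simp: W_def q0_def abs_if field_simps)
  have "((\<lambda>\<beta>. C_mSGD g n W \<beta>) \<longlongrightarrow> (g + real n) / (1 - q0)) (at_right 0)"
    unfolding C_mSGD_def q0_def
    by (intro tendsto_intros q_mSGD_tendsto) (use q0 in \<open>simp add: q0_def\<close>)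
  moreover have "((\<lambda>\<beta>. C_smSGD g n W (\<beta> * real n)) \<longlongrightarrow> g / (1 - q0)) (at_right 0)"
    unfolding C_smSGD_def q0_def
    by (intro tendsto_intros q_smSGD_tendsto \<open>n > 0\<close>) (use q0 in \<open>simp add: q0_def\<close>)
  ultimately have "((\<lambda>\<beta>. C_mSGD g n W \<beta> / C_smSGD g n W (\<beta> * real n)) \<longlongrightarrow>
      (g + real n) / (1 - q0) / (g / (1 - q0))) (at_right 0)"
    by (rule tendsto_divide) (use q0 \<open>g > 0\<close> in simp)
  moreover have "(g + real n) / (1 - q0) / (g / (1 - q0)) = 1 + real n / g"
    using q0 \<open>g > 0\<close> by (simp add: field_simps)
  ultimately show ?thesis by (simp add: W_def)
qed

end
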